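(* Let $n\geq 4$. Among all connected graphs on $n$ vertices with exactly $n-2$ pendant vertices, the tree $T(1,n-3,2)$ has the maximum core index. Furthermore, $F(T(1,n-3,2))=3\cdot 2^{n-3}+n$.
   Context: All graphs are finite, simple and undirected. A pendant vertex is a vertex of degree one. For positive integers $k,l,d$, $T(k,l,d)$ is the tree on $k+l+d$ vertices obtained from the path $v_1v_2\cdots v_d$ by attaching $k$ new pendant vertices to $v_1$ and $l$ new pendant vertices to $v_d$. A connected subgraph of a graph $G=(V,E)$ is a graph $(V',E')$ with $\emptyset\neq V'\subseteq V$, $E'\subseteq E$, every edge of $E'$ having both endpoints in $V'$, and $(V',E')$ connected; distinct pairs $(V',E')$ are counted separately. The core index $F(G)$ is the number of connected subgraphs of $G$. *)

theory Defs
  imports "Graph_Theory.Graph_Theory"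
begin

text \<open>
  A finite simple undirected graph is a \<^const>\<open>pair_graph\<close>: the undirected edge
  \<open>uv\<close> is represented by the two arcs \<open>(u, v)\<close> and \<open>(v, u)\<close>. The degree of a vertex
  is therefore its out-degree.
\<close>

definition pendant_vertices :: "'a pair_pre_digraph \<Rightarrow> 'a set" where
  "pendant_vertices G = {v \<in> pverts G. out_degree (with_proj G) v = 1}"

definition connected_graphs_with :: "nat \<Rightarrow> nat \<Rightarrow> 'a pair_pre_digraph set" where
  "connected_graphs_with n p =
    {G. pair_graph G \<and> connected (with_proj G) \<and>
        card (pverts G) = n \<and> card (pendant_vertices G) = p}"

text \<open>
  Requiring the subgraph to be a \<^const>\<open>pair_graph\<close> forces it to contain both or none of
  the two arcs of an edge, so undirected subgraphs are counted, each exactly once. The null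
  graph is excluded because \<^const>\<open>connected\<close> requires a vertex.
\<close>

definition connected_subgraphs :: "'a pair_pre_digraph \<Rightarrow> 'a pair_pre_digraph set" where
  "connected_subgraphs G =
    {H. pair_graph H \<and> subgraph (with_proj H) (with_proj G) \<and> connected (with_proj H)}"

definition core_index :: "'a pair_pre_digraph \<Rightarrow> nat" where
  "core_index G = card (connected_subgraphs G)"

text \<open>
  The vertices of \<open>T(k,l,d)\<close>: \<open>Spine i\<close> is \<open>v\<^sub>i\<close>, and the constructors \<open>LeafA\<close> and \<open>LeafB\<close>
  give the new vertices attached to \<open>v\<^sub>1\<close> and to \<open>v\<^sub>d\<close>.
\<close>

datatype tvert = Spine nat | LeafA nat | LeafB nat

definition T_edges :: "nat \<Rightarrow> nat \<Rightarrow> nat \<Rightarrow> tvert rel" where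
  "T_edges k l d =
     {(Spine i, Spine (i + 1)) | i. 1 \<le> i \<and> i < d} \<union>
     {(Spine 1, LeafA i) | i. 1 \<le> i \<and> i \<le> k} \<union>
     {(Spine d, LeafB i) | i. 1 \<le> i \<and> i \<le> l}"

definition T_tree :: "nat \<Rightarrow> nat \<Rightarrow> nat \<Rightarrow> tvert pair_pre_digraph" where
  "T_tree k l d =
     \<lparr> pverts = Spine ` {1..d} \<union> LeafA ` {1..k} \<union> LeafB ` {1..l},
       parcs = T_edges k l d \<union> (T_edges k l d)\<inverse> \<rparr>"

lemma card_pverts_T_tree: "card (pverts (T_tree k l d)) = k + l + d"
  by (subst T_tree_def, simp, subst card_Un_disjoint; (subst card_Un_disjoint)?)
     (auto simp: card_image inj_on_def)

lemma pair_graph_T_tree: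
  assumes "d \<ge> 1"
  shows "pair_graph (T_tree k l d)"
proof -
  have sub: "parcs (T_tree k l d) \<subseteq> pverts (T_tree k l d) \<times> pverts (T_tree k l d)"
    using assms by (auto simp: T_tree_def T_edges_def)
  have fin: "finite (pverts (T_tree k l d))"
    by (simp add: T_tree_def)
  have "finite (parcs (T_tree k l d))"
    using finite_subset[OF sub] fin by blast
  moreover have "symmetric (with_proj (T_tree k l d))"
    by (auto simp: symmetric_def sym_def T_tree_def)
  moreover have "\<And>e. e \<in> parcs (T_tree k l d) \<Longrightarrow> fst e \<noteq> snd e"
    by (auto simp: T_tree_def T_edges_def)
  ultimately show ?thesis
    using sub fin by unfold_locales auto
qed

end

theory Submission
  imports Defs
begin

text \<open>
  In a connected graph on \<open>n \<ge> 4\<close> vertices no two pendant vertices are adjacent, so with exactly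
  two non-pendant vertices \<open>u\<close>, \<open>w\<close> the graph is a double star: \<open>u\<close> and \<open>w\<close> are adjacent and
  carry \<open>a \<ge> 1\<close> and \<open>b \<ge> 1\<close> leaves, \<open>a + b = n - 2\<close>. A connected subgraph of a double star is
  induced by its vertex set, which is a single leaf, \<open>u\<close> with some of its leaves, \<open>w\<close> with
  some of its leaves, or both centres with any set of leaves. Hence the core index is
  \<open>(n - 2) + 2\<^sup>a + 2\<^sup>b + 2\<^bsup>n-2\<^esup>\<close>, and \<open>(2\<^bsup>a-1\<^esup> - 1) (2\<^bsup>b-1\<^esup> - 1) \<ge> 0\<close>
  shows that this is largest for \<open>{a, b} = {1, n - 3}\<close>.
\<close>

section \<open>Graphs as symmetric irreflexive relations, connectivity and cuts\<close>

lemma pair_graph_iff: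
  "pair_graph G \<longleftrightarrow> finite (pverts G) \<and> parcs G \<subseteq> pverts G \<times> pverts G \<and>
     sym (parcs G) \<and> irrefl (parcs G)" (is "?L \<longleftrightarrow> ?R")
proof
  assume ?L
  then interpret pair_graph G .
  show ?R
    using pair_finite_verts pair_sym_arcs pair_no_loops
    by (fastforce simp: symmetric_def irrefl_def dest: arc_fst_in_verts arc_snd_in_verts)
next
  assume R: ?R
  then have "finite (parcs G)"
    by (meson finite_SigmaI finite_subset)
  with R show ?L
    by unfold_locales (auto simp: symmetric_def irrefl_def)
qed

lemma subgraph_pair_graph_iff:
  assumes "pair_graph H" "pair_graph G"
  shows "subgraph (with_proj H) (with_proj G) \<longleftrightarrow> pverts H \<subseteq> pverts G \<and> parcs H \<subseteq> parcs G"
proof -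
  interpret H: pair_graph H by fact
  interpret G: pair_graph G by fact
  show ?thesis
    by (auto simp: subgraph_def compatible_def intro: H.wf_digraph G.wf_digraph)
qed

text \<open>Connectivity means strong connectivity of the symmetric closure. Here the arcs are
  already symmetric, so the closure changes nothing and reachability is plain
  \<open>rtrancl\<close>.\<close>

lemma connected_pair_graph_iff:
  assumes "pair_graph G"
  shows "connected (with_proj G) \<longleftrightarrow>
    pverts G \<noteq> {} \<and> (\<forall>x \<in> pverts G. \<forall>y \<in> pverts G. (x, y) \<in> (parcs G)\<^sup>*)"
proof -
  interpret pair_graph G by fact
  have "(parcs G)\<^sup>s = parcs G"
    using pair_sym_arcs by (auto simp: symcl_def symmetric_def dest: symD)
  then have "connected (with_proj G) \<longleftrightarrow> strongly_connected (with_proj G)"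
    by (simp add: connected_conv strongly_connected_def reachable_def)
  then show ?thesis
    by (auto simp: strongly_connected_def reachable_conv')
qed

text \<open>A set closed under outgoing arcs contains everything reachable from it. This is the
  source of all forced edges below: cutting off a single vertex, a pair of pendant vertices, or a
  centre with its leaves produces an edge across the cut.\<close>

lemma connected_pair_graph_cutE:
  assumes "pair_graph G" "connected (with_proj G)"
    and "S \<subseteq> pverts G" "S \<noteq> {}" "S \<noteq> pverts G"
  obtains x y where "x \<in> S" "y \<in> pverts G - S" "(x, y) \<in> parcs G"
proof -
  obtain s t where s: "s \<in> S" and t: "t \<in> pverts G" "t \<notin> S"
    using assms by auto
  have "(s, t) \<in> (parcs G)\<^sup>*"
    using assms s t by (auto simp: connected_pair_graph_iff)
  then have "t \<in> S" if "\<And>x y. x \<in> S \<Longrightarrow> (x, y) \<in> parcs G \<Longrightarrow> y \<in> S"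
    using s that by (induction rule: rtrancl_induct) auto
  with t obtain x y where "x \<in> S" "(x, y) \<in> parcs G" "y \<notin> S"
    by blast
  moreover have "y \<in> pverts G"
    using assms(1) \<open>(x, y) \<in> parcs G\<close> by (auto simp: pair_graph_iff)
  ultimately show ?thesis
    using that by blast
qed

text \<open>By symmetry, paths from \<open>r\<close> can be reversed, so any two vertices are joined
  through \<open>r\<close>.\<close>

lemma connected_pair_graphI_root:
  assumes "pair_graph G" "r \<in> pverts G" "\<And>x. x \<in> pverts G \<Longrightarrow> (r, x) \<in> (parcs G)\<^sup>*"
  shows "connected (with_proj G)"
proof -
  have "sym ((parcs G)\<^sup>*)"
    using assms(1) by (simp add: pair_graph_iff sym_rtrancl)
  then have "(x, y) \<in> (parcs G)\<^sup>*" if "x \<in> pverts G" "y \<in> pverts G" for x y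
    using assms(3)[OF that(1)] assms(3)[OF that(2)] by (meson rtrancl_trans symD)
  then show ?thesis
    using assms(1,2) by (auto simp: connected_pair_graph_iff)
qed

lemma out_degree_eq_card_Image:
  "out_degree (with_proj G) v = card (parcs G `` {v})"
proof -
  have "out_arcs (with_proj G) v = Pair v ` (parcs G `` {v})"
    by force
  then show ?thesis
    by (simp add: out_degree_def card_image inj_on_def)
qed

section \<open>Double stars and their connected subgraphs\<close>

text \<open>The leaf sets are parameters over any vertex type, so that the same results apply to the
  tree \<open>T_tree 1 (n - 3) 2\<close> and to its competitors.\<close>

definition double_star_graph :: "'a \<Rightarrow> 'a \<Rightarrow> 'a set \<Rightarrow> 'a set \<Rightarrow> 'a pair_pre_digraph" where
  "double_star_graph u w A B =
     \<lparr> pverts = {u, w} \<union> A \<union> B,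
       parcs = {(u, w), (w, u)} \<union> {u} \<times> A \<union> A \<times> {u} \<union> {w} \<times> B \<union> B \<times> {w} \<rparr>"

locale double_star =
  fixes u w :: 'a and A B :: "'a set"
  assumes finite_leaves: "finite A" "finite B"
    and centres_neq: "u \<noteq> w"
    and centres_not_leaves: "u \<notin> A \<union> B" "w \<notin> A \<union> B"
    and leaves_disjoint: "A \<inter> B = {}"
begin

abbreviation DS :: "'a pair_pre_digraph" where
  "DS \<equiv> double_star_graph u w A B"

lemma pair_graph_DS: "pair_graph DS"
  using finite_leaves centres_neq centres_not_leaves leaves_disjoint
  by (auto simp: pair_graph_iff double_star_graph_def sym_def irrefl_def)

lemma card_pverts_DS: "card (pverts DS) = card A + card B + 2"
  using finite_leaves centres_neq centres_not_leaves leaves_disjoint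
  by (simp add: double_star_graph_def card_Un_disjoint)

text \<open>Each centre has one neighbour more than it has leaves, so nonempty leaf sets keep both
  centres from being pendant.\<close>

lemma pendant_vertices_DS:
  assumes "A \<noteq> {}" "B \<noteq> {}"
  shows "pendant_vertices DS = A \<union> B"
proof -
  note facts = finite_leaves centres_neq centres_not_leaves leaves_disjoint
  have u: "parcs DS `` {u} = insert w A" and w: "parcs DS `` {w} = insert u B"
    using facts by (auto simp: double_star_graph_def)
  have A: "parcs DS `` {x} = {u}" if "x \<in> A" for x
    using facts that by (auto simp: double_star_graph_def)
  have B: "parcs DS `` {x} = {w}" if "x \<in> B" for x
    using facts that by (auto simp: double_star_graph_def)
  have "card (insert w A) \<noteq> 1" "card (insert u B) \<noteq> 1"
    using facts assms by auto
  with u w A B show ?thesis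
    using facts
    by (auto simp: pendant_vertices_def out_degree_eq_card_Image)
       (auto simp: double_star_graph_def)
qed

text \<open>The singletons of the first family are leaves only: \<open>{u}\<close> and
  \<open>{w}\<close> come from the empty set in the second and third families. This keeps the four
  families disjoint.\<close>

definition vertex_sets :: "'a set set" where
  "vertex_sets = (\<lambda>x. {x}) ` (A \<union> B) \<union> insert u ` Pow A \<union> insert w ` Pow B \<union>
     (\<lambda>S. {u, w} \<union> S) ` Pow (A \<union> B)"

definition induced :: "'a set \<Rightarrow> 'a pair_pre_digraph" where
  "induced V = \<lparr> pverts = V, parcs = parcs DS \<inter> V \<times> V \<rparr>"

lemma pair_graph_induced:
  assumes "V \<subseteq> pverts DS"
  shows "pair_graph (induced V)"
  using pair_graph_DS assms
  by (auto simp: pair_graph_iff induced_def sym_def irrefl_def intro: finite_subset)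

text \<open>A root is the lone leaf or a centre that is present. With both centres, \<open>u\<close>
  serves as root and leaves of \<open>w\<close> are reached through \<open>w\<close>.\<close>

lemma connected_induced:
  assumes V: "V \<in> vertex_sets"
  shows "connected (with_proj (induced V))"
proof -
  have VG: "V \<subseteq> pverts DS"
    using V by (auto simp: vertex_sets_def double_star_graph_def)
  have root: ?thesis if "r \<in> V" "\<And>x. x \<in> V \<Longrightarrow> (r, x) \<in> (parcs (induced V))\<^sup>*" for r
    using connected_pair_graphI_root[OF pair_graph_induced[OF VG], of r] that
    by (simp add: induced_def)
  consider x where "V = {x}" | S where "V = insert u S" "S \<subseteq> A" | S where "V = insert w S" "S \<subseteq> B"
    | S where "V = {u, w} \<union> S" "S \<subseteq> A \<union> B"
    using V unfolding vertex_sets_def by blast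
  then show ?thesis
  proof cases
    case 1
    then show ?thesis by (intro root) auto
  next
    case 2
    then have "(u, x) \<in> parcs (induced V)" if "x \<in> S" for x
      using that by (auto simp: induced_def double_star_graph_def)
    with 2 show ?thesis
      by (intro root[of u]) auto
  next
    case 3
    then have "(w, x) \<in> parcs (induced V)" if "x \<in> S" for x
      using that by (auto simp: induced_def double_star_graph_def)
    with 3 show ?thesis
      by (intro root[of w]) auto
  next
    case 4
    have uw: "(u, w) \<in> parcs (induced V)"
      using 4 by (auto simp: induced_def double_star_graph_def)
    have "(u, x) \<in> parcs (induced V) \<or> (w, x) \<in> parcs (induced V)" if "x \<in> S" for x
      using 4 that by (auto simp: induced_def double_star_graph_def)
    with uw have "(u, x) \<in> (parcs (induced V))\<^sup>*" if "x \<in> S" for x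
      using that by (meson r_into_rtrancl rtrancl.rtrancl_into_rtrancl)
    with uw 4 show ?thesis
      by (intro root[of u]) auto
  qed
qed

lemma connected_subgraph_is_induced:
  assumes H: "pair_graph H" "connected (with_proj H)"
    and sub: "pverts H \<subseteq> pverts DS" "parcs H \<subseteq> parcs DS"
  shows "pverts H \<in> vertex_sets" and "H = induced (pverts H)"
proof -
  note facts = finite_leaves centres_neq centres_not_leaves leaves_disjoint
  have wf: "parcs H \<subseteq> pverts H \<times> pverts H" and sym: "sym (parcs H)" and irr: "irrefl (parcs H)"
    using H(1) by (auto simp: pair_graph_iff)
  have ne: "pverts H \<noteq> {}"
    using H by (simp add: connected_pair_graph_iff)
  have "pverts H \<in> vertex_sets \<and> parcs H = parcs DS \<inter> pverts H \<times> pverts H"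
  proof (cases "\<exists>x. pverts H = {x}")
    case True
    then obtain x where x: "pverts H = {x}" by blast
    have "parcs H = {}" "parcs DS \<inter> {x} \<times> {x} = {}"
      using wf irr pair_graph_DS x by (auto simp: irrefl_def pair_graph_iff)
    moreover have "{x} \<in> vertex_sets"
      using sub(1) x by (auto simp: vertex_sets_def double_star_graph_def)
    ultimately show ?thesis
      using x by simp
  next
    case False
    have nbr: "\<exists>y. (x, y) \<in> parcs H" if "x \<in> pverts H" for x
    proof -
      have "{x} \<subseteq> pverts H" "{x} \<noteq> {}" "{x} \<noteq> pverts H"
        using that False by auto
      then show ?thesis
        by (elim connected_pair_graph_cutE[OF H]) auto
    qed
    have A: "(x, u) \<in> parcs H" if "x \<in> A" "x \<in> pverts H" for x
      using nbr[OF that(2)] that sub(2) facts by (auto simp: double_star_graph_def)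
    have B: "(x, w) \<in> parcs H" if "x \<in> B" "x \<in> pverts H" for x
      using nbr[OF that(2)] that sub(2) facts by (auto simp: double_star_graph_def)
    have uw: "(u, w) \<in> parcs H" if "u \<in> pverts H" "w \<in> pverts H"
    proof -
      \<comment> \<open>The only arc of \<open>DS\<close> that leaves the side of \<open>u\<close>
        is \<open>(u, w)\<close>, so the arc crossing this cut must be that one.\<close>
      let ?S = "insert u A \<inter> pverts H"
      have "?S \<subseteq> pverts H" "?S \<noteq> {}" "?S \<noteq> pverts H"
        using that facts by auto
      then obtain x y where "x \<in> ?S" "y \<in> pverts H - ?S" "(x, y) \<in> parcs H"
        by (elim connected_pair_graph_cutE[OF H])
      with sub(2) facts show ?thesis
        by (auto simp: double_star_graph_def)
    qed
    have "parcs DS \<inter> pverts H \<times> pverts H \<subseteq> parcs H"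
      using A B uw sym by (auto simp: double_star_graph_def dest: symD)
    moreover have "pverts H \<in> vertex_sets"
    proof -
      have VA: "pverts H \<inter> A = {}" if "u \<notin> pverts H"
        using A wf that by blast
      have VB: "pverts H \<inter> B = {}" if "w \<notin> pverts H"
        using B wf that by blast
      have V: "pverts H \<subseteq> {u, w} \<union> A \<union> B"
        using sub(1) by (simp add: double_star_graph_def)
      \<comment> \<open>The case of neither centre is excluded: it would leave no leaves either,
        hence no vertices.\<close>
      consider "u \<in> pverts H" "w \<in> pverts H" | "u \<in> pverts H" "w \<notin> pverts H"
        | "u \<notin> pverts H" "w \<in> pverts H"
        using V VA VB ne by blast
      then show ?thesis
      proof cases
        case 1
        then have "pverts H = {u, w} \<union> (pverts H - {u, w})" "pverts H - {u, w} \<subseteq> A \<union> B"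
          using V by auto
        then show ?thesis unfolding vertex_sets_def by blast
      next
        case 2
        then have "pverts H = insert u (pverts H - {u})" "pverts H - {u} \<subseteq> A"
          using V VB by auto
        then show ?thesis unfolding vertex_sets_def by blast
      next
        case 3
        then have "pverts H = insert w (pverts H - {w})" "pverts H - {w} \<subseteq> B"
          using V VA by auto
        then show ?thesis unfolding vertex_sets_def by blast
      qed
    qed
    ultimately show ?thesis
      using wf sub(2) by blast
  qed
  then show "pverts H \<in> vertex_sets" and "H = induced (pverts H)"
    by (auto simp: induced_def)
qed

lemma connected_subgraphs_DS: "connected_subgraphs DS = induced ` vertex_sets"
proof (intro equalityI subsetI)
  fix H assume "H \<in> connected_subgraphs DS"
  then have "pair_graph H" "connected (with_proj H)"
      "pverts H \<subseteq> pverts DS" "parcs H \<subseteq> parcs DS"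
    by (auto simp: connected_subgraphs_def subgraph_pair_graph_iff[OF _ pair_graph_DS])
  from connected_subgraph_is_induced[OF this] show "H \<in> induced ` vertex_sets"
    by blast
next
  fix H assume "H \<in> induced ` vertex_sets"
  then obtain V where V: "V \<in> vertex_sets" "H = induced V"
    by blast
  then have "V \<subseteq> pverts DS"
    by (auto simp: vertex_sets_def double_star_graph_def)
  then have "pair_graph H" "pverts H \<subseteq> pverts DS" "parcs H \<subseteq> parcs DS"
    using V pair_graph_induced by (auto simp: induced_def)
  with V connected_induced show "H \<in> connected_subgraphs DS"
    by (simp add: connected_subgraphs_def subgraph_pair_graph_iff[OF _ pair_graph_DS])
qed

section \<open>Counting the connected subgraphs\<close>

lemma card_vertex_sets:
  "card vertex_sets = card A + card B + 2 ^ card A + 2 ^ card B + 2 ^ (card A + card B)"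
proof -
  note facts = finite_leaves centres_neq centres_not_leaves leaves_disjoint
  let ?L = "(\<lambda>x. {x}) ` (A \<union> B)" and ?U = "insert u ` Pow A" and ?W = "insert w ` Pow B"
    and ?UW = "(\<lambda>S. {u, w} \<union> S) ` Pow (A \<union> B)"
  have "card ?L = card A + card B"
    using facts by (simp add: card_image card_Un_disjoint)
  moreover have "inj_on (insert u) (Pow A)" "inj_on (insert w) (Pow B)"
    using facts by (auto intro!: inj_onI simp: insert_ident)
  then have "card ?U = 2 ^ card A" "card ?W = 2 ^ card B"
    using facts by (simp_all add: card_image card_Pow)
  moreover have "inj_on (\<lambda>S. {u, w} \<union> S) (Pow (A \<union> B))"
    \<comment> \<open>Deleting the two centres recovers \<open>S\<close>, which consists of
      leaves.\<close>
    using facts by (intro inj_on_inverseI[where g = "\<lambda>V. V - {u, w}"]) auto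
  then have "card ?UW = 2 ^ (card A + card B)"
    using facts by (simp add: card_image card_Pow card_Un_disjoint)
  moreover have "card (?L \<union> ?U \<union> ?W \<union> ?UW) = card ?L + card ?U + card ?W + card ?UW"
  proof -
    \<comment> \<open>The centres contained in a set (none, \<open>u\<close>, \<open>w\<close> or
      both) tell its family.\<close>
    have "?L \<inter> ?U = {}" "(?L \<union> ?U) \<inter> ?W = {}" "(?L \<union> ?U \<union> ?W) \<inter> ?UW = {}"
      using facts by auto
    moreover have "finite ?L" "finite ?U" "finite ?W" "finite ?UW"
      using facts by auto
    ultimately show ?thesis
      by (simp add: card_Un_disjoint del: Un_insert_left)
  qed
  ultimately show ?thesis
    unfolding vertex_sets_def by presburger
qed

theorem core_index_DS:
  "core_index DS = card A + card B + 2 ^ card A + 2 ^ card B + 2 ^ (card A + card B)"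
proof -
  have "inj_on induced vertex_sets"
    by (auto intro!: inj_onI simp: induced_def)
  then show ?thesis
    by (simp add: core_index_def connected_subgraphs_DS card_image card_vertex_sets)
qed

lemma DS_in_connected_graphs_with:
  assumes "A \<noteq> {}" "B \<noteq> {}"
  shows "DS \<in> connected_graphs_with (card A + card B + 2) (card A + card B)"
proof -
  \<comment> \<open>The whole graph is the subgraph induced by both centres and all leaves, so its
    connectivity is an instance of \<open>connected_induced\<close>.\<close>
  have "pverts DS \<in> vertex_sets"
    by (auto simp: vertex_sets_def double_star_graph_def)
  moreover have "induced (pverts DS) = DS"
    using pair_graph_DS by (simp add: induced_def pair_graph_iff Int_absorb2)
  ultimately have "connected (with_proj DS)"
    using connected_induced by metis
  moreover have "card (pendant_vertices DS) = card A + card B"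
    using assms finite_leaves leaves_disjoint by (simp add: pendant_vertices_DS card_Un_disjoint)
  ultimately show ?thesis
    by (simp add: connected_graphs_with_def pair_graph_DS card_pverts_DS)
qed

end

section \<open>Connected graphs with exactly two non-pendant vertices\<close>

text \<open>The two non-pendant vertices become the centres. Every pendant vertex hangs from exactly
  one of them, connectivity joins them, and each needs a leaf because otherwise the other centre
  would be its only neighbour.\<close>

lemma connected_graphs_with_two_nonpendant_is_double_star:
  assumes n: "n \<ge> 4" and G: "G \<in> connected_graphs_with n (n - 2)"
  obtains u w A B where "double_star u w A B" "A \<noteq> {}" "B \<noteq> {}" "G = double_star_graph u w A B"
proof -
  define P where "P = pendant_vertices G"
  have pg: "pair_graph G" and con: "connected (with_proj G)"
    and cardV: "card (pverts G) = n" and cardP: "card P = n - 2"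
    using G by (auto simp: connected_graphs_with_def P_def)
  have fin: "finite (pverts G)" and wf: "parcs G \<subseteq> pverts G \<times> pverts G"
    and sym: "sym (parcs G)" and irr: "irrefl (parcs G)"
    using pg by (auto simp: pair_graph_iff)
  have PV: "P \<subseteq> pverts G"
    by (auto simp: P_def pendant_vertices_def)
  then have "card (pverts G - P) = 2"
    using n cardV cardP fin by (simp add: card_Diff_subset finite_subset)
  then obtain u w where uw: "pverts G - P = {u, w}" "u \<noteq> w"
    by (auto simp: card_2_iff)
  have P1: "\<exists>y. parcs G `` {x} = {y}" if "x \<in> P" for x
    using that by (simp add: P_def pendant_vertices_def out_degree_eq_card_Image card_1_singleton_iff)
  have P_nbr: "parcs G `` {x} = {y}" if "x \<in> P" "(x, y) \<in> parcs G" for x y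
    using P1[OF that(1)] that(2) by (metis Image_singleton_iff singletonD)
  \<comment> \<open>Two adjacent pendant vertices have no further neighbours and would form a
    component of two vertices, against \<open>n \<ge> 4\<close>.\<close>
  have indep: "(x, y) \<notin> parcs G" if "x \<in> P" "y \<in> P" for x y
  proof
    assume xy: "(x, y) \<in> parcs G"
    then have yx: "(y, x) \<in> parcs G"
      using sym by (auto dest: symD)
    have "{x, y} \<noteq> pverts G"
    proof
      assume "{x, y} = pverts G"
      then have "card (pverts G) \<le> 2"
        by (simp add: card_insert_if flip: \<open>{x, y} = pverts G\<close>)
      then show False using n cardV by simp
    qed
    moreover have "{x, y} \<subseteq> pverts G" "{x, y} \<noteq> {}"
      using that PV by auto
    ultimately obtain a b where "a \<in> {x, y}" "b \<in> pverts G - {x, y}" "(a, b) \<in> parcs G"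
      by (elim connected_pair_graph_cutE[OF pg con])
    then show False
      using P_nbr that xy yx by blast
  qed
  define A where "A = {x \<in> P. (x, u) \<in> parcs G}"
  define B where "B = {x \<in> P. (x, w) \<in> parcs G}"
  have AB: "A \<union> B = P"
  proof -
    have "x \<in> A \<union> B" if x: "x \<in> P" for x
    proof -
      obtain y where "(x, y) \<in> parcs G"
        using P1[OF x] by blast
      moreover have "y \<in> {u, w}"
        using indep[OF x, of y] calculation wf uw(1) by blast
      ultimately show ?thesis
        using x by (auto simp: A_def B_def)
    qed
    then show ?thesis by (auto simp: A_def B_def)
  qed
  have disj: "A \<inter> B = {}"
    using P_nbr uw(2) by (fastforce simp: A_def B_def)
  have uV: "u \<in> pverts G" "w \<in> pverts G" and uP: "u \<notin> P" "w \<notin> P"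
    using uw by auto
  have V: "pverts G = {u, w} \<union> A \<union> B"
    using AB uw(1) PV by blast
  have nA: "parcs G `` {x} = {u}" if "x \<in> A" for x
    using P_nbr that by (simp add: A_def)
  have nB: "parcs G `` {x} = {w}" if "x \<in> B" for x
    using P_nbr that by (simp add: B_def)
  \<comment> \<open>An edge must leave \<open>insert u A\<close>. It cannot start in
    \<open>A\<close>, whose vertices see only \<open>u\<close>, nor end in \<open>B\<close>, whose
    vertices see only \<open>w\<close>; so it runs from \<open>u\<close> to
    \<open>w\<close>.\<close>
  have arc: "(u, w) \<in> parcs G"
  proof -
    have "insert u A \<subseteq> pverts G" "insert u A \<noteq> {}" "insert u A \<noteq> pverts G"
      using V uV uP uw(2) AB by auto
    then obtain x y where xy: "x \<in> insert u A" "y \<in> pverts G - insert u A" "(x, y) \<in> parcs G"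
      by (elim connected_pair_graph_cutE[OF pg con])
    then have "x = u" using nA by blast
    moreover have "y \<notin> B"
    proof
      assume "y \<in> B"
      moreover have "(y, u) \<in> parcs G"
        using xy \<open>x = u\<close> sym by (auto dest: symD)
      ultimately show False using nB uw(2) by blast
    qed
    ultimately show ?thesis using xy V by auto
  qed
  then have arc': "(w, u) \<in> parcs G"
    using sym by (auto dest: symD)
  have star: "double_star u w A B"
    using fin V uw(2) uP AB disj by unfold_locales auto
  have nu: "parcs G `` {u} = insert w A"
  proof -
    \<comment> \<open>The pendant neighbours of \<open>u\<close> form \<open>A\<close> by
      definition; among the two other vertices, irreflexivity rules out \<open>u\<close> and leaves
      \<open>w\<close>.\<close>
    have "x \<in> insert w A \<longleftrightarrow> (x, u) \<in> parcs G" for x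
      using arc' wf irr V AB by (cases "x \<in> P") (auto simp: A_def irrefl_def)
    then show ?thesis using sym by (auto dest: symD)
  qed
  have nw: "parcs G `` {w} = insert u B"
  proof -
    have "x \<in> insert u B \<longleftrightarrow> (x, w) \<in> parcs G" for x
      using arc wf irr V AB by (cases "x \<in> P") (auto simp: B_def irrefl_def)
    then show ?thesis using sym by (auto dest: symD)
  qed
  \<comment> \<open>If \<open>A\<close> were empty, \<open>u\<close> would have the single neighbour
    \<open>w\<close> and be pendant; likewise for \<open>B\<close> and \<open>w\<close>.\<close>
  have "A \<noteq> {}" "B \<noteq> {}"
    using nu nw uP uV by (auto simp: P_def pendant_vertices_def out_degree_eq_card_Image)
  moreover have "parcs G = parcs (double_star_graph u w A B)"
  proof -
    have "(x, y) \<in> parcs G \<longleftrightarrow> (x, y) \<in> parcs (double_star_graph u w A B)" for x y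
    proof (cases "x \<in> pverts G")
      case True
      then consider "x = u" | "x = w" | "x \<in> A" | "x \<in> B" using V by blast
      then have "parcs G `` {x} = parcs (double_star_graph u w A B) `` {x}"
        by cases (use nu nw nA nB uw(2) uP AB disj in \<open>auto simp: double_star_graph_def\<close>)
      then show ?thesis by blast
    next
      case False
      then show ?thesis
        using wf V by (auto simp: double_star_graph_def)
    qed
    then show ?thesis by auto
  qed
  then have "G = double_star_graph u w A B"
    using V by (simp add: double_star_graph_def)
  ultimately show ?thesis
    using that star by blast
qed

section \<open>The power inequality and the extremal tree\<close>

lemma sum_two_powers_le:
  fixes a b :: nat
  assumes "a \<ge> 1" "b \<ge> 1"
  shows "(2::nat) ^ a + 2 ^ b \<le> 2 + 2 ^ (a + b - 1)"
proof -
  obtain i j where ij: "a = Suc i" "b = Suc j"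
    using assms by (metis Suc_le_D One_nat_def)
  \<comment> \<open>Writing the powers as successors avoids subtraction: the right side exceeds the
    left by \<open>2 * x * y\<close>.\<close>
  obtain x y :: nat where "2 ^ i = Suc x" "2 ^ j = Suc y"
    by (metis Suc_pred zero_less_numeral zero_less_power)
  then show ?thesis
    by (simp add: ij power_add)
qed

theorem theorem5p2:
  fixes n :: nat
  assumes "n \<ge> 4"
  shows "T_tree 1 (n - 3) 2 \<in> connected_graphs_with n (n - 2) \<and>
    (\<forall>G :: 'a pair_pre_digraph. G \<in> connected_graphs_with n (n - 2) \<longrightarrow>
       core_index G \<le> core_index (T_tree 1 (n - 3) 2)) \<and>
    core_index (T_tree 1 (n - 3) 2) = 3 * 2 ^ (n - 3) + n"
proof -
  \<comment> \<open>For \<open>d = 2\<close> the spine is just the central edge, so the tree is a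
    double star with one leaf at \<open>Spine 1\<close> and \<open>n - 3\<close> leaves at
    \<open>Spine 2\<close>.\<close>
  define A B where "A = {LeafA 1}" and "B = LeafB ` {1..n - 3}"
  interpret T: double_star "Spine 1" "Spine 2" A B
    by unfold_locales (auto simp: A_def B_def)
  have T_eq: "T_tree 1 (n - 3) 2 = T.DS"
  proof -
    have "{1..2::nat} = {1, 2}" by auto
    moreover have "T_edges 1 (n - 3) 2 = {(Spine 1, Spine 2)} \<union> {Spine 1} \<times> A \<union> {Spine 2} \<times> B"
    proof -
      have i: "1 \<le> i \<and> i < 2 \<longleftrightarrow> i = 1" for i :: nat by auto
      have "{(Spine i, Spine (i + 1)) | i. 1 \<le> i \<and> i < 2} = {(Spine 1, Spine 2)}"
        unfolding i by (auto simp: numeral_2_eq_2)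
      moreover have "{(Spine 1, LeafA i) | i. 1 \<le> i \<and> i \<le> 1} = {Spine 1} \<times> A"
        by (auto simp: A_def)
      moreover have "{(Spine 2, LeafB i) | i. 1 \<le> i \<and> i \<le> n - 3} = {Spine 2} \<times> B"
        by (auto simp: B_def)
      ultimately show ?thesis
        by (simp only: T_edges_def)
    qed
    ultimately show ?thesis
      by (auto simp: T_tree_def double_star_graph_def A_def B_def)
  qed
  have card_A: "card A = 1" and card_B: "card B = n - 3"
    by (simp_all add: A_def B_def card_image inj_on_def)
  have ne: "A \<noteq> {}" "B \<noteq> {}"
    using assms by (auto simp: A_def B_def)
  \<comment> \<open>This substitution turns the truncated differences \<open>n - 2\<close> and
    \<open>n - 3\<close> into sums.\<close>
  obtain m where m: "n = m + 4"
    using assms by (metis add.commute le_Suc_ex)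
  have core_T: "core_index (T_tree 1 (n - 3) 2) = 3 * 2 ^ (n - 3) + n"
    unfolding T_eq T.core_index_DS card_A card_B by (simp add: m)
  moreover have "T_tree 1 (n - 3) 2 \<in> connected_graphs_with n (n - 2)"
    using T.DS_in_connected_graphs_with[OF ne] unfolding T_eq card_A card_B
    by (simp add: m numeral_eq_Suc)
  moreover have "core_index G \<le> 3 * 2 ^ (n - 3) + n"
    if G: "G \<in> connected_graphs_with n (n - 2)" for G :: "'a pair_pre_digraph"
  proof -
    obtain u w :: 'a and C D where star: "double_star u w C D" "C \<noteq> {}" "D \<noteq> {}"
      and G_eq: "G = double_star_graph u w C D"
      using connected_graphs_with_two_nonpendant_is_double_star[OF assms G] by metis
    interpret G: double_star u w C D by fact
    \<comment> \<open>The sum comes from counting vertices: the two centres and all leaves make up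
      \<open>n\<close>.\<close>
    have CD: "card C \<ge> 1" "card D \<ge> 1" "card C + card D = n - 2"
      using star G.finite_leaves G.card_pverts_DS G unfolding G_eq connected_graphs_with_def
      by (auto simp: Suc_le_eq card_gt_0_iff)
    have "(2::nat) ^ card C + 2 ^ card D \<le> 2 + 2 ^ (n - 3)"
      using sum_two_powers_le[OF CD(1,2)] CD(3) by (simp add: m)
    \<comment> \<open>Adding the fixed terms \<open>n - 2\<close> and \<open>2 ^ (n - 2)\<close> to
      the bound gives \<open>n + 2 ^ (n - 3) + 2 * 2 ^ (n - 3)\<close>.\<close>
    then show ?thesis
      unfolding G_eq G.core_index_DS CD(3) using CD(3) by (simp add: m)
  qed
  ultimately show ?thesis
    by simp
qed

end
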